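(* Let $l, u \in \mathbb{R}$ with $l < 0 < u$, and let $x, y \in \mathbb{R}$ with $l \le x \le u$. Then $y = \max(x, 0)$ if and only if there exists $a \in \{0, 1\}$ such that $$ y \le x - l(1-a), \qquad y \ge x, \qquad y \le u \cdot a, \qquad y \ge 0. $$
   Context: The bounds $l \le x \le u$ are a priori bounds on the input $x$ of a ReLU unit. The unit is called unstable when neither $u \le 0$ nor $l \ge 0$ holds, i.e. when $l < 0 < u$. The variable $a$ is the binary indicator decision variable for the phase of the ReLU (intended as the indicator of $x \ge 0$). *)

theory Defs
  imports Complex_Main
begin

end

theory Submission
  imports Defs
begin

theorem mainTheorem1:
  fixes l u x y :: real
  assumes "l < 0" and "0 < u"
    and "l \<le> x" and "x \<le> u"
  shows "y = max x 0 \<longleftrightarrow>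
    (\<exists>a\<in>{0, 1::real}. y \<le> x - l * (1 - a) \<and> y \<ge> x \<and> y \<le> u * a \<and> y \<ge> 0)"
  \<comment> \<open>Each \<open>a\<close> selects one linear piece: \<open>a = 1\<close> squeezes
    \<open>y\<close> between \<open>x\<close> and \<open>x\<close>, \<open>a = 0\<close> between 0
    and 0, with \<open>y \<ge> 0\<close> resp. \<open>y \<ge> x\<close> fixing the sign of
    \<open>x\<close>. Conversely take \<open>a = 1\<close> if \<open>x > 0\<close>, else
    \<open>a = 0\<close>; the relaxed upper bound is then just \<open>x \<le> u\<close> resp.
    \<open>l \<le> x\<close>. Unfolding \<open>max\<close> gives this case split.\<close>
  using assms by (auto simp: max_def)

end
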